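(* For every admissible price vector $\bm{x}$, the penalty $\beta(\bm{x},\Gamma)$ admits the dual representation $$\beta(\bm{x},\Gamma)=\min_{\theta\ge0}\Big\{\Gamma\theta+\sum_{i=1}^n\max\{0,\ |t_i(x_i)|-\theta\}\Big\}.$$ Consequently, the robust margin constraint $\sum_{i=1}^n s_i(x_i)-\beta(\bm{x},\Gamma)\ge0$ holds if and only if there exists $\theta\ge0$ such that $$\sum_{i=1}^n\Big(s_i(x_i)-\max\{0,\ |t_i(x_i)|-\theta\}\Big)\ \ge\ \Gamma\theta.$$ For any fixed $\theta\ge0$, the left-hand side of this last inequality is separable across items (i.e. it is a sum over $i$ of functions each depending only on $x_i$).
   Context: Data. There are items $i=1,\dots,n$. Item $i$ has a finite price menu $\mathcal X_i\subset\mathbb R$, a reference price $a_i>0$, an exposure $\omega_i>0$, a nominal demand function $\hat g_i:\mathcal X_i\to\mathbb R_{>0}$ (monotone decreasing on the admissible range), and a relative tolerance $\sigma_i$. A margin target $\Delta>0$ and an integer budget $\Gamma\in\{0,1,\dots,n\}$ are given. The admissible menu $\mathcal X_i^{\mathrm{ad}}=\mathcal X_i\cap[(1-\sigma_i)a_i,(1+\sigma_i)a_i]$ is assumed nonempty; an admissible price vector has $x_i\in\mathcal X_i^{\mathrm{ad}}$ for all $i$. A variability parameter $\delta_i(x_i)$ is given with $0\le\delta_i(x_i)<\hat g_i(x_i)$ on $\mathcal X_i^{\mathrm{ad}}$. Put $s_i(x_i)=\omega_i(x_i-\Delta a_i)\hat g_i(x_i)$, $t_i(x_i)=\omega_i(x_i-\Delta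 a_i)\delta_i(x_i)$. The penalty is the sum of the $\Gamma$ largest values among $\{|t_i(x_i)|\}_{i=1}^n$, i.e. $$\beta(\bm{x},\Gamma)=\max_{\bm{\xi}}\Big\{\sum_{i=1}^n|t_i(x_i)|\,\xi_i:\ \sum_{i=1}^n\xi_i\le\Gamma,\ 0\le\xi_i\le1\ \forall i\Big\}.$$ *)

theory Defs
  imports Complex_Main
begin

definition admissible_menu ::
    "(nat \<Rightarrow> real set) \<Rightarrow> (nat \<Rightarrow> real) \<Rightarrow> (nat \<Rightarrow> real) \<Rightarrow> nat \<Rightarrow> real set" where
  "admissible_menu X a \<sigma> i = X i \<inter> {(1 - \<sigma> i) * a i .. (1 + \<sigma> i) * a i}"

(* Price vectors are functions on nat of which only the entries 1..n matter. *)
definition admissible_prices ::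
    "nat \<Rightarrow> (nat \<Rightarrow> real set) \<Rightarrow> (nat \<Rightarrow> real) \<Rightarrow> (nat \<Rightarrow> real) \<Rightarrow> (nat \<Rightarrow> real) set" where
  "admissible_prices n X a \<sigma> = {x. \<forall>i\<in>{1..n}. x i \<in> admissible_menu X a \<sigma> i}"

definition nominal_term ::
    "(nat \<Rightarrow> real) \<Rightarrow> (nat \<Rightarrow> real) \<Rightarrow> real \<Rightarrow> (nat \<Rightarrow> real \<Rightarrow> real) \<Rightarrow> nat \<Rightarrow> real \<Rightarrow> real" where
  "nominal_term a \<omega> \<Delta> g i p = \<omega> i * (p - \<Delta> * a i) * g i p"

definition deviation_term ::
    "(nat \<Rightarrow> real) \<Rightarrow> (nat \<Rightarrow> real) \<Rightarrow> real \<Rightarrow> (nat \<Rightarrow> real \<Rightarrow> real) \<Rightarrow> nat \<Rightarrow> real \<Rightarrow> real" where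
  "deviation_term a \<omega> \<Delta> \<delta> i p = \<omega> i * (p - \<Delta> * a i) * \<delta> i p"

definition budget_set :: "nat \<Rightarrow> nat \<Rightarrow> (nat \<Rightarrow> real) set" where
  "budget_set n \<Gamma> = {\<xi>. (\<Sum>i=1..n. \<xi> i) \<le> real \<Gamma> \<and> (\<forall>i\<in>{1..n}. 0 \<le> \<xi> i \<and> \<xi> i \<le> 1)}"

(* Max is only meaningful on finite sets, hence Sup; by penalty_attained the supremum is a
   maximum, and by penalty_eq_sum_largest it is the sum of the \<Gamma> largest values \<bar>t i (x i)\<bar>. *)
definition penalty ::
    "nat \<Rightarrow> (nat \<Rightarrow> real \<Rightarrow> real) \<Rightarrow> (nat \<Rightarrow> real) \<Rightarrow> nat \<Rightarrow> real" where
  "penalty n t x \<Gamma> = (SUP \<xi>\<in>budget_set n \<Gamma>. \<Sum>i=1..n. \<bar>t i (x i)\<bar> * \<xi> i)"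

definition dual_objective ::
    "nat \<Rightarrow> (nat \<Rightarrow> real \<Rightarrow> real) \<Rightarrow> (nat \<Rightarrow> real) \<Rightarrow> nat \<Rightarrow> real \<Rightarrow> real" where
  "dual_objective n t x \<Gamma> \<theta> = real \<Gamma> * \<theta> + (\<Sum>i=1..n. max 0 (\<bar>t i (x i)\<bar> - \<theta>))"

definition robust_lhs ::
    "nat \<Rightarrow> (nat \<Rightarrow> real \<Rightarrow> real) \<Rightarrow> (nat \<Rightarrow> real \<Rightarrow> real) \<Rightarrow> real \<Rightarrow> (nat \<Rightarrow> real) \<Rightarrow> real" where
  "robust_lhs n s t \<theta> x = (\<Sum>i=1..n. s i (x i) - max 0 (\<bar>t i (x i)\<bar> - \<theta>))"

definition separable_on :: "nat \<Rightarrow> (nat \<Rightarrow> real) set \<Rightarrow> ((nat \<Rightarrow> real) \<Rightarrow> real) \<Rightarrow> bool" where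
  "separable_on n D F \<longleftrightarrow> (\<exists>h :: nat \<Rightarrow> real \<Rightarrow> real. \<forall>x\<in>D. F x = (\<Sum>i=1..n. h i (x i)))"

lemma budget_optimum:
  fixes w :: "nat \<Rightarrow> real"
  assumes G: "\<Gamma> \<le> n" and w0: "\<And>i. 0 \<le> w i"
  shows "\<exists>S \<subseteq> {1..n}. card S = \<Gamma> \<and> (\<forall>\<xi>\<in>budget_set n \<Gamma>. (\<Sum>i=1..n. w i * \<xi> i) \<le> sum w S)"
proof -
  let ?F = "{S. S \<subseteq> {1..n} \<and> card S = \<Gamma>}"
  have fin: "finite ?F" by (rule finite_subset[of _ "Pow {1..n}"]) auto
  have "?F \<noteq> {}" using obtain_subset_with_card_n[of \<Gamma> "{1..n}"] G by auto
  then have "Max (sum w ` ?F) \<in> sum w ` ?F" using fin by (intro Max_in) auto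
  then obtain S where S: "S \<subseteq> {1..n}" "card S = \<Gamma>" and SM: "sum w S = Max (sum w ` ?F)"
    by force
  have best: "sum w T \<le> sum w S" if "T \<subseteq> {1..n}" "card T = \<Gamma>" for T
    unfolding SM using that fin by (intro Max_ge) auto
  have finS: "finite S" using S(1) finite_subset by blast
  have exch: "w j \<le> w i" if i: "i \<in> S" and j: "j \<in> {1..n} - S" for i j
  proof -
    let ?T = "insert j (S - {i})"
    have "card ?T = \<Gamma>"
      using i j finS S(2) card_Suc_Diff1[of S i] by auto
    moreover have "?T \<subseteq> {1..n}" using S j by auto
    ultimately have "sum w ?T \<le> sum w S" by (rule best[rotated])
    moreover have "sum w ?T = w j + (sum w S - w i)"
      using i j finS by (simp add: sum_diff1)
    ultimately show ?thesis by simp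
  qed
  have "(\<Sum>i=1..n. w i * \<xi> i) \<le> sum w S" if xi: "\<xi> \<in> budget_set n \<Gamma>" for \<xi>
  proof (cases "S = {}")
    case True
    have xs: "sum \<xi> {1..n} \<le> 0" "\<And>i. i \<in> {1..n} \<Longrightarrow> 0 \<le> \<xi> i"
      using xi S True by (auto simp: budget_set_def)
    then have "sum \<xi> {1..n} = 0" by (meson sum_nonneg order_antisym)
    then have "\<forall>i\<in>{1..n}. \<xi> i = 0"
      using xs(2) sum_nonneg_eq_0_iff[of "{1..n}" \<xi>] by blast
    then show ?thesis using True by simp
  next
    case False
    define \<theta> where "\<theta> = Min (w ` S)"
    have lo: "\<theta> \<le> w i" if "i \<in> S" for i using that finS by (simp add: \<theta>_def)
    have "\<theta> \<in> w ` S" using False finS unfolding \<theta>_def by (intro Min_in) auto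
    then obtain i0 where i0: "i0 \<in> S" "\<theta> = w i0" by blast
    have th0: "0 \<le> \<theta>" using i0 w0 by simp
    have hi: "w j \<le> \<theta>" if "j \<in> {1..n} - S" for j using exch[OF i0(1) that] i0 by simp
    have xb: "0 \<le> \<xi> i" "\<xi> i \<le> 1" if "i \<in> {1..n}" for i
      using xi that by (auto simp: budget_set_def)
    have "(\<Sum>i=1..n. w i * \<xi> i) = (\<Sum>i=1..n. (w i - \<theta>) * \<xi> i) + \<theta> * sum \<xi> {1..n}"
      by (simp add: sum_distrib_left sum.distrib[symmetric] algebra_simps)
    also have "\<dots> \<le> (\<Sum>i=1..n. if i \<in> S then w i - \<theta> else 0) + \<theta> * real \<Gamma>"
    proof (rule add_mono)
      show "(\<Sum>i=1..n. (w i - \<theta>) * \<xi> i) \<le> (\<Sum>i=1..n. if i \<in> S then w i - \<theta> else 0)"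
      proof (rule sum_mono)
        fix i assume i: "i \<in> {1..n}"
        show "(w i - \<theta>) * \<xi> i \<le> (if i \<in> S then w i - \<theta> else 0)"
          using lo[of i] hi[of i] xb[OF i] i
          by (auto intro: mult_left_le mult_nonpos_nonneg)
      qed
      show "\<theta> * sum \<xi> {1..n} \<le> \<theta> * real \<Gamma>"
        using xi th0 by (intro mult_left_mono) (auto simp: budget_set_def)
    qed
    also have "(\<Sum>i=1..n. if i \<in> S then w i - \<theta> else 0) = (\<Sum>i\<in>S. w i - \<theta>)"
      using S(1) by (simp add: sum.If_cases Int_absorb1)
    also have "(\<Sum>i\<in>S. w i - \<theta>) + \<theta> * real \<Gamma> = sum w S"
      using S(2) by (simp add: sum_subtractf)
    finally show ?thesis .
  qed
  then show ?thesis using S by blast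
qed

lemma subset_value_feasible:
  assumes "S \<subseteq> {1..n}" "card S = \<Gamma>"
  shows "\<exists>\<xi>\<in>budget_set n \<Gamma>. (\<Sum>i=1..n. w i * \<xi> i) = sum w S"
proof
  let ?\<xi> = "\<lambda>i. if i \<in> S then 1 else 0 :: real"
  have I: "{1..n} \<inter> S = S" using assms by auto
  show "?\<xi> \<in> budget_set n \<Gamma>"
    using assms I by (auto simp: budget_set_def sum.If_cases)
  show "(\<Sum>i=1..n. w i * ?\<xi> i) = sum w S"
    using I by (simp add: if_distrib[of "(*) _"] sum.If_cases cong: if_cong)
qed

lemma penalty_attained:
  assumes "\<Gamma> \<le> n"
  shows "\<exists>\<xi>\<in>budget_set n \<Gamma>. penalty n t x \<Gamma> = (\<Sum>i=1..n. \<bar>t i (x i)\<bar> * \<xi> i)"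
    and "\<xi>' \<in> budget_set n \<Gamma> \<Longrightarrow> (\<Sum>i=1..n. \<bar>t i (x i)\<bar> * \<xi>' i) \<le> penalty n t x \<Gamma>"
proof -
  let ?w = "\<lambda>i. \<bar>t i (x i)\<bar>"
  let ?V = "(\<lambda>\<xi>. \<Sum>i=1..n. ?w i * \<xi> i) ` budget_set n \<Gamma>"
  obtain S where S: "S \<subseteq> {1..n}" "card S = \<Gamma>"
    and ub: "\<forall>\<xi>\<in>budget_set n \<Gamma>. (\<Sum>i=1..n. ?w i * \<xi> i) \<le> sum ?w S"
    using budget_optimum[OF assms, of ?w] by auto
  obtain \<xi> where \<xi>: "\<xi> \<in> budget_set n \<Gamma>" "(\<Sum>i=1..n. ?w i * \<xi> i) = sum ?w S"
    using subset_value_feasible[OF S, of ?w] by blast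
  have "penalty n t x \<Gamma> = sum ?w S"
    unfolding penalty_def by (rule cSup_eq_maximum) (use \<xi> ub in \<open>auto intro!: rev_image_eqI\<close>)
  then show "\<exists>\<xi>\<in>budget_set n \<Gamma>. penalty n t x \<Gamma> = (\<Sum>i=1..n. ?w i * \<xi> i)"
    and "\<xi>' \<in> budget_set n \<Gamma> \<Longrightarrow> (\<Sum>i=1..n. ?w i * \<xi>' i) \<le> penalty n t x \<Gamma>"
    using \<xi> ub by (metis, metis)
qed

lemma penalty_eq_sum_largest:
  assumes "\<Gamma> \<le> n"
  shows "penalty n t x \<Gamma> = Max {(\<Sum>i\<in>S. \<bar>t i (x i)\<bar>) | S. S \<subseteq> {1..n} \<and> card S = \<Gamma>}"
proof -
  let ?w = "\<lambda>i. \<bar>t i (x i)\<bar>"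
  let ?M = "{sum ?w S | S. S \<subseteq> {1..n} \<and> card S = \<Gamma>}"
  obtain S where S: "S \<subseteq> {1..n}" "card S = \<Gamma>"
    and ub: "\<forall>\<xi>\<in>budget_set n \<Gamma>. (\<Sum>i=1..n. ?w i * \<xi> i) \<le> sum ?w S"
    using budget_optimum[OF assms, of ?w] by auto
  have feas: "\<exists>\<xi>\<in>budget_set n \<Gamma>. (\<Sum>i=1..n. ?w i * \<xi> i) = sum ?w T"
    if "T \<subseteq> {1..n}" "card T = \<Gamma>" for T
    using subset_value_feasible[OF that, of ?w] .
  have le: "sum ?w T \<le> penalty n t x \<Gamma>" if "T \<subseteq> {1..n}" "card T = \<Gamma>" for T
    using feas[OF that] penalty_attained(2)[OF assms, of _ t x] by metis
  have "penalty n t x \<Gamma> \<le> sum ?w S" using ub penalty_attained(1)[OF assms, of t x] by auto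
  with le[OF S] have eq: "penalty n t x \<Gamma> = sum ?w S" by simp
  have "finite ?M"
    by (rule finite_subset[of _ "sum ?w ` Pow {1..n}"]) auto
  moreover have "penalty n t x \<Gamma> \<in> ?M" using S eq by blast
  ultimately show ?thesis using le by (intro Max_eqI[symmetric]) auto
qed

end

theory Submission
  imports Defs
begin

text \<open>
  The penalty is the optimal value of a fractional knapsack with unit weights, and the
  representation is linear programming duality for it. Weak duality holds because a unit of
  budget spent on item \<open>i\<close> earns \<open>\<bar>t i (x i)\<bar>\<close>, which is at most the price \<open>\<theta>\<close> of that unit plus
  the excess \<open>max 0 (\<bar>t i (x i)\<bar> - \<theta>)\<close>, and at most one unit can be spent on each item
  (\<open>penalty_le_dual_objective\<close>).

  For the reverse inequality, let \<open>S\<close> be a set of \<open>\<Gamma>\<close> items with the largest deviations. Any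
  \<open>\<theta> \<ge> 0\<close> that lies between the deviations outside \<open>S\<close> and those inside \<open>S\<close> closes the gap:
  only items of \<open>S\<close> have a positive excess, and the \<open>\<Gamma>\<close> copies of \<open>\<theta>\<close> subtracted in
  these excesses cancel the term \<open>\<Gamma> * \<theta>\<close>, which leaves the sum of the deviations over \<open>S\<close>
  (\<open>penalty_eq_dual_objective\<close>). Such a threshold exists because no exchange of an item of
  \<open>S\<close> for one outside \<open>S\<close> increases the sum (\<open>largest_sum_threshold\<close>).

  Since the dual is a minimum that is attained, the penalty is at most a given bound exactly when
  some dual value is; with the sum of the nominal terms as the bound, this is the equivalence of
  the two forms of the margin constraint.
\<close>

lemma penalty_le_dual_objective:
  assumes "\<Gamma> \<le> n" and "0 \<le> \<theta>"
  shows "penalty n t x \<Gamma> \<le> dual_objective n t x \<Gamma> \<theta>"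
proof -
  let ?w = "\<lambda>i. \<bar>t i (x i)\<bar>"
  obtain \<xi> where \<xi>: "\<xi> \<in> budget_set n \<Gamma>" and pen: "penalty n t x \<Gamma> = (\<Sum>i=1..n. ?w i * \<xi> i)"
    using penalty_attained(1)[OF assms(1)] by blast
  have "(\<Sum>i=1..n. ?w i * \<xi> i) \<le> (\<Sum>i=1..n. \<theta> * \<xi> i + max 0 (?w i - \<theta>))"
  proof (rule sum_mono)
    fix i assume "i \<in> {1..n}"
    then have xi: "0 \<le> \<xi> i" "\<xi> i \<le> 1" using \<xi> by (auto simp: budget_set_def)
    have "(?w i - \<theta>) * \<xi> i \<le> max 0 (?w i - \<theta>) * \<xi> i"
      using xi(1) by (intro mult_right_mono) auto
    also have "\<dots> \<le> max 0 (?w i - \<theta>)"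
      using xi(2) by (intro mult_left_le) auto
    finally show "?w i * \<xi> i \<le> \<theta> * \<xi> i + max 0 (?w i - \<theta>)"
      by (simp add: algebra_simps)
  qed
  also have "\<dots> = \<theta> * sum \<xi> {1..n} + (\<Sum>i=1..n. max 0 (?w i - \<theta>))"
    by (simp add: sum.distrib sum_distrib_left)
  also have "\<dots> \<le> \<theta> * real \<Gamma> + (\<Sum>i=1..n. max 0 (?w i - \<theta>))"
    using \<xi> assms(2) by (intro add_right_mono mult_left_mono) (auto simp: budget_set_def)
  finally show ?thesis
    by (simp add: pen dual_objective_def mult.commute)
qed

text \<open>
  The witness is the largest weight outside \<open>S\<close>, replaced by \<open>0\<close> if it is negative or if
  nothing lies outside \<open>S\<close>. It cannot exceed a weight inside \<open>S\<close>, since otherwise swapping the two elements would give a heavier set of the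
  same size.
\<close>

lemma largest_sum_threshold:
  fixes w :: "'a \<Rightarrow> real"
  assumes fin: "finite I" and S: "S \<subseteq> I" and w0: "\<And>i. i \<in> S \<Longrightarrow> 0 \<le> w i"
    and best: "\<And>T. T \<subseteq> I \<Longrightarrow> card T = card S \<Longrightarrow> sum w T \<le> sum w S"
  obtains \<theta> where "0 \<le> \<theta>" "\<And>i. i \<in> S \<Longrightarrow> \<theta> \<le> w i" "\<And>j. j \<in> I - S \<Longrightarrow> w j \<le> \<theta>"
proof
  let ?\<theta> = "Max (insert 0 (w ` (I - S)))"
  have finS: "finite S" using S fin by (rule finite_subset)
  show "0 \<le> ?\<theta>" using fin by simp
  show "w j \<le> ?\<theta>" if "j \<in> I - S" for j using that fin by (intro Max_ge) auto
  show "?\<theta> \<le> w i" if i: "i \<in> S" for i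
  proof -
    have "w j \<le> w i" if j: "j \<in> I - S" for j
    proof -
      let ?T = "insert j (S - {i})"
      have "card ?T = card S" using i j finS card_Suc_Diff1[of S i] by auto
      then have "sum w ?T \<le> sum w S" using S j by (intro best) auto
      moreover have "sum w ?T = w j + (sum w S - w i)"
        using i j finS by (simp add: sum_diff1)
      ultimately show ?thesis by simp
    qed
    then show ?thesis using fin w0[OF i] by (intro Max.boundedI) auto
  qed
qed

lemma penalty_eq_dual_objective:
  assumes "\<Gamma> \<le> n"
  shows "\<exists>\<theta>\<ge>0. penalty n t x \<Gamma> = dual_objective n t x \<Gamma> \<theta>"
proof -
  let ?w = "\<lambda>i. \<bar>t i (x i)\<bar>"
  let ?M = "{sum ?w S | S. S \<subseteq> {1..n} \<and> card S = \<Gamma>}"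
  have finM: "finite ?M" by (rule finite_subset[of _ "sum ?w ` Pow {1..n}"]) auto
  have "?M \<noteq> {}" using obtain_subset_with_card_n[of \<Gamma> "{1..n}"] assms by auto
  with finM have "Max ?M \<in> ?M" by (rule Max_in)
  then obtain S where S: "S \<subseteq> {1..n}" "card S = \<Gamma>" and max: "Max ?M = sum ?w S"
    by blast
  have "sum ?w T \<le> sum ?w S" if "T \<subseteq> {1..n}" "card T = card S" for T
    unfolding max[symmetric] using that S finM by (intro Max_ge) auto
  then obtain \<theta> where \<theta>: "0 \<le> \<theta>" and lo: "\<And>i. i \<in> S \<Longrightarrow> \<theta> \<le> ?w i"
    and hi: "\<And>j. j \<in> {1..n} - S \<Longrightarrow> ?w j \<le> \<theta>"
    using largest_sum_threshold[of "{1..n}" S ?w] S(1) by auto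
  have "(\<Sum>i=1..n. max 0 (?w i - \<theta>)) = (\<Sum>i\<in>S. ?w i - \<theta>)"
    using S(1) lo hi by (intro sum.mono_neutral_cong_right) auto
  then have "dual_objective n t x \<Gamma> \<theta> = sum ?w S"
    using S(2) by (simp add: dual_objective_def sum_subtractf)
  then show ?thesis
    using \<theta> max penalty_eq_sum_largest[OF assms, of t x] by auto
qed

lemma robust_constraint_iff_dual:
  assumes "\<Gamma> \<le> n"
  shows "(\<Sum>i=1..n. s i (x i)) - penalty n t x \<Gamma> \<ge> 0 \<longleftrightarrow>
    (\<exists>\<theta>\<ge>0. robust_lhs n s t \<theta> x \<ge> real \<Gamma> * \<theta>)"
proof -
  have "robust_lhs n s t \<theta> x \<ge> real \<Gamma> * \<theta> \<longleftrightarrow> dual_objective n t x \<Gamma> \<theta> \<le> (\<Sum>i=1..n. s i (x i))"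
    for \<theta>
    by (auto simp: robust_lhs_def dual_objective_def sum_subtractf)
  then show ?thesis
    using penalty_eq_dual_objective[OF assms, of t x]
      penalty_le_dual_objective[OF assms, of _ t x] by force
qed

lemma separable_on_robust_lhs: "separable_on n D (robust_lhs n s t \<theta>)"
  unfolding separable_on_def robust_lhs_def
  by (rule exI[of _ "\<lambda>i p. s i p - max 0 (\<bar>t i p\<bar> - \<theta>)"]) simp

theorem theorem6:
  fixes n \<Gamma> :: nat
    and X :: "nat \<Rightarrow> real set"
    and a \<omega> \<sigma> :: "nat \<Rightarrow> real"
    and g \<delta> :: "nat \<Rightarrow> real \<Rightarrow> real"
    and \<Delta> :: real
  assumes finite_menu: "\<forall>i\<in>{1..n}. finite (X i)"
    and ref_pos: "\<forall>i\<in>{1..n}. 0 < a i"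
    and exposure_pos: "\<forall>i\<in>{1..n}. 0 < \<omega> i"
    and demand_pos: "\<forall>i\<in>{1..n}. \<forall>p\<in>X i. 0 < g i p"
    and demand_decreasing: "\<forall>i\<in>{1..n}. antimono_on (admissible_menu X a \<sigma> i) (g i)"
    and target_pos: "0 < \<Delta>"
    and budget: "\<Gamma> \<le> n"
    and admissible_nonempty: "\<forall>i\<in>{1..n}. admissible_menu X a \<sigma> i \<noteq> {}"
    and variability: "\<forall>i\<in>{1..n}. \<forall>p\<in>admissible_menu X a \<sigma> i. 0 \<le> \<delta> i p \<and> \<delta> i p < g i p"
  shows "let s = nominal_term a \<omega> \<Delta> g; t = deviation_term a \<omega> \<Delta> \<delta>; A = admissible_prices n X a \<sigma> in
    (\<forall>x\<in>A. (\<exists>\<theta>\<ge>0. penalty n t x \<Gamma> = dual_objective n t x \<Gamma> \<theta>) \<and>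
            (\<forall>\<theta>\<ge>0. penalty n t x \<Gamma> \<le> dual_objective n t x \<Gamma> \<theta>)) \<and>
    (\<forall>x\<in>A. (\<Sum>i=1..n. s i (x i)) - penalty n t x \<Gamma> \<ge> 0 \<longleftrightarrow>
            (\<exists>\<theta>\<ge>0. robust_lhs n s t \<theta> x \<ge> real \<Gamma> * \<theta>)) \<and>
    (\<forall>\<theta>\<ge>0. separable_on n A (robust_lhs n s t \<theta>))"
  unfolding Let_def
  using penalty_eq_dual_objective[OF budget] penalty_le_dual_objective[OF budget]
    robust_constraint_iff_dual[OF budget] separable_on_robust_lhs
  by blast

end
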